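(* Let $n\ge 2$ and let $V$ be a finite-dimensional indecomposable calibrated representation of $\mathcal{V}_n$ on which some $e_i$, $1\le i\le n-1$, acts by a nonzero operator. Then the element $\widetilde{\Theta}=\prod_{1\le i<j\le n}\bigl(1-(y_i-y_j)^2\bigr)\in\mathcal{V}_n$ acts by $0$ on $V$.
   Context: For $n\ge 1$, the degenerate affine periplectic Brauer algebra $\mathcal{V}_n$ is the unital associative $\mathbb{C}$-algebra with generators $s_i,e_i$ ($1\le i\le n-1$) and $y_j$ ($1\le j\le n$) and relations (for all indices for which the expressions make sense): $s_i^2=1$; $s_is_j=s_js_i$, $s_ie_j=e_js_i$, $e_ie_j=e_je_i$ if $|i-j|>1$; $s_is_{i+1}s_i=s_{i+1}s_is_{i+1}$; $y_iy_j=y_jy_i$; $e_iy_j=y_je_i$ and $s_iy_j=y_js_i$ if $j\ne i,i+1$; $e_{i+1}e_ie_{i+1}=-e_{i+1}$; $e_ie_{i+1}e_i=-e_i$; $e_is_i=e_i$; $s_ie_i=-e_i$; $s_ie_{i+1}e_i=s_{i+1}e_i$; $s_{i+1}e_ie_{i+1}=-s_ie_{i+1}$; $e_{i+1}e_is_{i+1}=e_{i+1}s_i$; $e_ie_{i+1}s_i=-e_is_{i+1}$; $e_i^2=0$; $s_iy_i-y_{i+1}s_i=-e_i-1$; $y_is_i-s_iy_{i+1}=e_i-1$; $e_i(y_i-y_{i+1})=-e_i$; $(y_i-y_{i+1})e_i=e_i$. A representation $V$ of $\mathcal{V}_n$ is called calibrated if $V$ has a basis with respect to which $y_j$ acts by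 a diagonal matrix for all $j=1,\dots,n$ simultaneously. All representations are finite-dimensional over $\mathbb{C}$. *)

theory Defs
  imports Complex_Main "HOL-Library.Poly_Mapping" "HOL-Algebra.QuotRing"
begin

datatype gen = Gen_s nat | Gen_e nat | Gen_y nat

(* Words under concatenation, written additively so that the convolution product of
   finitely supported functions on words is the product of the free associative algebra. *)
datatype word = Word (letters: "gen list")

instantiation word :: monoid_add
begin
definition "0 = Word []"
definition "u + v = Word (letters u @ letters v)"
instance by standard (auto simp: zero_word_def plus_word_def)
end

type_synonym free_alg = "word \<Rightarrow>\<^sub>0 complex"

definition fscalar :: "complex \<Rightarrow> free_alg"
  where "fscalar c = Poly_Mapping.single 0 c"

definition fgen :: "gen \<Rightarrow> free_alg"
  where "fgen g = Poly_Mapping.single (Word [g]) 1"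

abbreviation fs :: "nat \<Rightarrow> free_alg" where "fs i \<equiv> fgen (Gen_s i)"
abbreviation fe :: "nat \<Rightarrow> free_alg" where "fe i \<equiv> fgen (Gen_e i)"
abbreviation fy :: "nat \<Rightarrow> free_alg" where "fy j \<equiv> fgen (Gen_y j)"

definition gens :: "nat \<Rightarrow> gen set"
  where "gens n = Gen_s ` {1..n-1} \<union> Gen_e ` {1..n-1} \<union> Gen_y ` {1..n}"

definition free_algebra :: "nat \<Rightarrow> free_alg ring" where
  "free_algebra n =
     \<lparr>carrier = {p. \<forall>w \<in> Poly_Mapping.keys p. set (letters w) \<subseteq> gens n},
      mult = (*), one = 1, zero = 0, add = (+)\<rparr>"

(* An element  l - r  stands for the relation  l = r. *)
inductive_set relators :: "nat \<Rightarrow> free_alg set" for n :: nat where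
  ss: "i \<in> {1..n-1} \<Longrightarrow> fs i * fs i - 1 \<in> relators n"
| s_s: "i \<in> {1..n-1} \<Longrightarrow> j \<in> {1..n-1} \<Longrightarrow> \<bar>int i - int j\<bar> > 1
    \<Longrightarrow> fs i * fs j - fs j * fs i \<in> relators n"
| s_e: "i \<in> {1..n-1} \<Longrightarrow> j \<in> {1..n-1} \<Longrightarrow> \<bar>int i - int j\<bar> > 1
    \<Longrightarrow> fs i * fe j - fe j * fs i \<in> relators n"
| e_e: "i \<in> {1..n-1} \<Longrightarrow> j \<in> {1..n-1} \<Longrightarrow> \<bar>int i - int j\<bar> > 1
    \<Longrightarrow> fe i * fe j - fe j * fe i \<in> relators n"
| braid: "i \<in> {1..n-1} \<Longrightarrow> i + 1 \<in> {1..n-1}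
    \<Longrightarrow> fs i * fs (i+1) * fs i - fs (i+1) * fs i * fs (i+1) \<in> relators n"
| y_y: "i \<in> {1..n} \<Longrightarrow> j \<in> {1..n}
    \<Longrightarrow> fy i * fy j - fy j * fy i \<in> relators n"
| e_y: "i \<in> {1..n-1} \<Longrightarrow> j \<in> {1..n} \<Longrightarrow> j \<noteq> i \<Longrightarrow> j \<noteq> i + 1
    \<Longrightarrow> fe i * fy j - fy j * fe i \<in> relators n"
| s_y: "i \<in> {1..n-1} \<Longrightarrow> j \<in> {1..n} \<Longrightarrow> j \<noteq> i \<Longrightarrow> j \<noteq> i + 1
    \<Longrightarrow> fs i * fy j - fy j * fs i \<in> relators n"
| e'ee': "i \<in> {1..n-1} \<Longrightarrow> i + 1 \<in> {1..n-1}
    \<Longrightarrow> fe (i+1) * fe i * fe (i+1) - (- fe (i+1)) \<in> relators n"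
| ee'e: "i \<in> {1..n-1} \<Longrightarrow> i + 1 \<in> {1..n-1}
    \<Longrightarrow> fe i * fe (i+1) * fe i - (- fe i) \<in> relators n"
| es: "i \<in> {1..n-1} \<Longrightarrow> fe i * fs i - fe i \<in> relators n"
| se: "i \<in> {1..n-1} \<Longrightarrow> fs i * fe i - (- fe i) \<in> relators n"
| se'e: "i \<in> {1..n-1} \<Longrightarrow> i + 1 \<in> {1..n-1}
    \<Longrightarrow> fs i * fe (i+1) * fe i - fs (i+1) * fe i \<in> relators n"
| s'ee': "i \<in> {1..n-1} \<Longrightarrow> i + 1 \<in> {1..n-1}
    \<Longrightarrow> fs (i+1) * fe i * fe (i+1) - (- (fs i * fe (i+1))) \<in> relators n"
| e'es': "i \<in> {1..n-1} \<Longrightarrow> i + 1 \<in> {1..n-1}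
    \<Longrightarrow> fe (i+1) * fe i * fs (i+1) - fe (i+1) * fs i \<in> relators n"
| ee's: "i \<in> {1..n-1} \<Longrightarrow> i + 1 \<in> {1..n-1}
    \<Longrightarrow> fe i * fe (i+1) * fs i - (- (fe i * fs (i+1))) \<in> relators n"
| ee: "i \<in> {1..n-1} \<Longrightarrow> fe i * fe i \<in> relators n"
| sy: "i \<in> {1..n-1}
    \<Longrightarrow> (fs i * fy i - fy (i+1) * fs i) - (- fe i - 1) \<in> relators n"
| ys: "i \<in> {1..n-1}
    \<Longrightarrow> (fy i * fs i - fs i * fy (i+1)) - (fe i - 1) \<in> relators n"
| ey: "i \<in> {1..n-1}
    \<Longrightarrow> fe i * (fy i - fy (i+1)) - (- fe i) \<in> relators n"
| ye: "i \<in> {1..n-1}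
    \<Longrightarrow> (fy i - fy (i+1)) * fe i - fe i \<in> relators n"

definition rel_ideal :: "nat \<Rightarrow> free_alg set"
  where "rel_ideal n = genideal (free_algebra n) (relators n)"

definition periplectic :: "nat \<Rightarrow> free_alg set ring"
  where "periplectic n = free_algebra n Quot rel_ideal n"

definition cls :: "nat \<Rightarrow> free_alg \<Rightarrow> free_alg set"
  where "cls n p = rel_ideal n +>\<^bsub>free_algebra n\<^esub> p"

lemma letters_plus[simp]: "letters (u+v) = letters u @ letters v" by (simp add: plus_word_def)

lemma letters_zero[simp]: "letters 0 = []" by (simp add: zero_word_def)

lemma ring_free_algebra: "ring (free_algebra n)"
proof (rule ringI)
  have k: "Poly_Mapping.keys (x + y) \<subseteq> Poly_Mapping.keys x \<union> Poly_Mapping.keys y" for x y :: free_alg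
    by (rule Poly_Mapping.keys_add)
  have m: "Poly_Mapping.keys (x * y) \<subseteq> {a + b | a b. a \<in> Poly_Mapping.keys x \<and> b \<in> Poly_Mapping.keys y}" for x y :: free_alg
    by (rule keys_mult)
  show "abelian_group (free_algebra n)"
  proof (rule abelian_groupI)
    fix x y assume "x \<in> carrier (free_algebra n)" "y \<in> carrier (free_algebra n)"
    then show "x \<oplus>\<^bsub>free_algebra n\<^esub> y \<in> carrier (free_algebra n)"
      using k[of x y] by (fastforce simp: free_algebra_def)
  next
    fix x assume "x \<in> carrier (free_algebra n)"
    then show "\<exists>y\<in>carrier (free_algebra n). y \<oplus>\<^bsub>free_algebra n\<^esub> x = \<zero>\<^bsub>free_algebra n\<^esub>"
      by (intro bexI[of _ "-x"]) (auto simp: free_algebra_def)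
  qed (auto simp: free_algebra_def algebra_simps)
  show "Group.monoid (free_algebra n)"
  proof
    fix x y assume "x \<in> carrier (free_algebra n)" "y \<in> carrier (free_algebra n)"
    then show "x \<otimes>\<^bsub>free_algebra n\<^esub> y \<in> carrier (free_algebra n)"
      using m[of x y] by (fastforce simp: free_algebra_def)
  qed (auto simp: free_algebra_def mult.assoc keys_one)
qed (auto simp: free_algebra_def algebra_simps)

lemma fgen_in: "g \<in> gens n \<Longrightarrow> fgen g \<in> carrier (free_algebra n)"
  by (auto simp: fgen_def free_algebra_def split: if_splits)

lemma free_algebra_mult_in: "x \<in> carrier (free_algebra n) \<Longrightarrow> y \<in> carrier (free_algebra n) \<Longrightarrow> x * y \<in> carrier (free_algebra n)"
  using ring.ring_simprules(5)[OF ring_free_algebra, of x n y] by (simp add: free_algebra_def)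

lemma free_algebra_add_in: "x \<in> carrier (free_algebra n) \<Longrightarrow> y \<in> carrier (free_algebra n) \<Longrightarrow> x + y \<in> carrier (free_algebra n)"
  using ring.ring_simprules(1)[OF ring_free_algebra, of x n y] by (simp add: free_algebra_def)

lemma free_algebra_neg_in: "x \<in> carrier (free_algebra n) \<Longrightarrow> - x \<in> carrier (free_algebra n)"
  by (simp add: free_algebra_def)

lemma free_algebra_minus_in: "x \<in> carrier (free_algebra n) \<Longrightarrow> y \<in> carrier (free_algebra n) \<Longrightarrow> x - y \<in> carrier (free_algebra n)"
  using free_algebra_add_in[of x n "-y"] free_algebra_neg_in[of y n] by simp

lemma free_algebra_one_in: "1 \<in> carrier (free_algebra n)" 
  by (simp add: free_algebra_def keys_one)

lemma gens_in: "i \<in> {1..n-1} \<Longrightarrow> Gen_s i \<in> gens n" "i \<in> {1..n-1} \<Longrightarrow> Gen_e i \<in> gens n" "i \<in> {1..n} \<Longrightarrow> Gen_y i \<in> gens n"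
   by (auto simp: gens_def)

lemma fscalar_in: "fscalar c \<in> carrier (free_algebra n)"
  by (auto simp: fscalar_def free_algebra_def split: if_splits)

lemma relators_in: "relators n \<subseteq> carrier (free_algebra n)"
proof
  fix x assume "x \<in> relators n" then show "x \<in> carrier (free_algebra n)"
    by induction (intro free_algebra_minus_in free_algebra_mult_in free_algebra_neg_in free_algebra_one_in fgen_in gens_in; auto)+
qed

lemma ideal_rel: "ideal (rel_ideal n) (free_algebra n)"
  unfolding rel_ideal_def by (rule ring.genideal_ideal[OF ring_free_algebra relators_in])

lemma ring_periplectic: "ring (periplectic n)"
  unfolding periplectic_def by (rule ideal.quotient_is_ring[OF ideal_rel])

lemma cls_hom: "cls n \<in> ring_hom (free_algebra n) (periplectic n)"
  using ideal.rcos_ring_hom[OF ideal_rel] unfolding periplectic_def cls_def by simp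

lemma cls_rel: assumes "x \<in> relators n" shows "cls n x = \<zero>\<^bsub>periplectic n\<^esub>"
proof -
  interpret ideal "rel_ideal n" "free_algebra n" by (rule ideal_rel)
  have "x \<in> rel_ideal n"
    using assms ring.genideal_self[OF ring_free_algebra relators_in] by (auto simp: rel_ideal_def)
  then show ?thesis
    unfolding cls_def periplectic_def FactRing_def by (simp add: a_coset_join2 a_rcos_const)
qed

(* The y's commute only after passing to the quotient, so the product over the pairs i < j
   is formed in lexicographic order; its class does not depend on that order. *)
definition Theta :: "nat \<Rightarrow> free_alg set" where
  "Theta n = cls n (prod_list
     [1 - (fy i - fy j)^2. i \<leftarrow> [1..<n+1], j \<leftarrow> [i+1..<n+1]])"

definition End_ring :: "(complex \<Rightarrow> 'v \<Rightarrow> 'v) \<Rightarrow> ('v::ab_group_add \<Rightarrow> 'v) ring" where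
  "End_ring scale =
     \<lparr>carrier = {f. Vector_Spaces.linear scale scale f},
      mult = (\<circ>), one = id, zero = (\<lambda>v. 0), add = (\<lambda>f g v. f v + g v)\<rparr>"

lemma ring_End_ring: assumes "vector_space (scale :: complex \<Rightarrow> 'v::ab_group_add \<Rightarrow> 'v)"
  shows "ring (End_ring scale)"
proof -
  interpret vector_space scale by fact
  interpret P: vector_space_pair scale scale by unfold_locales
  show ?thesis
  proof (rule ringI)
    show "abelian_group (End_ring scale)"
    proof (rule abelian_groupI)
     fix f assume "f \<in> carrier (End_ring scale)"
     then show "\<exists>y\<in>carrier (End_ring scale). y \<oplus>\<^bsub>End_ring scale\<^esub> f = \<zero>\<^bsub>End_ring scale\<^esub>"
       by (intro bexI[of _ "\<lambda>v. - f v"]) (auto simp: End_ring_def P.linear_compose_neg)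
    qed (auto simp: End_ring_def P.linear_compose_add P.linear_zero algebra_simps)
    show "Group.monoid (End_ring scale)"
      by unfold_locales (auto simp: End_ring_def Vector_Spaces.linear_compose linear_id o_assoc)
  qed (auto simp: End_ring_def fun_eq_iff linear_def module_hom.add dest: Vector_Spaces.linear.axioms)
qed

(* A unital algebra homomorphism into the endomorphisms of the complex vector space
   ('v, scale): a ring homomorphism compatible with the scalars. *)
definition fin_dim_rep ::
    "nat \<Rightarrow> (complex \<Rightarrow> 'v \<Rightarrow> 'v) \<Rightarrow> (free_alg set \<Rightarrow> 'v::ab_group_add \<Rightarrow> 'v) \<Rightarrow> bool" where
  "fin_dim_rep n scale \<rho> \<longleftrightarrow>
     (\<exists>B. finite_dimensional_vector_space scale B) \<and>
     \<rho> \<in> ring_hom (periplectic n) (End_ring scale) \<and>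
     (\<forall>c. \<rho> (cls n (fscalar c)) = scale c)"

definition subrep ::
    "nat \<Rightarrow> (complex \<Rightarrow> 'v \<Rightarrow> 'v) \<Rightarrow> (free_alg set \<Rightarrow> 'v::ab_group_add \<Rightarrow> 'v) \<Rightarrow> 'v set \<Rightarrow> bool" where
  "subrep n scale \<rho> U \<longleftrightarrow>
     module.subspace scale U \<and> (\<forall>a \<in> carrier (periplectic n). \<forall>u \<in> U. \<rho> a u \<in> U)"

definition indecomposable ::
    "nat \<Rightarrow> (complex \<Rightarrow> 'v \<Rightarrow> 'v) \<Rightarrow> (free_alg set \<Rightarrow> 'v::ab_group_add \<Rightarrow> 'v) \<Rightarrow> bool" where
  "indecomposable n scale \<rho> \<longleftrightarrow>
     (UNIV :: 'v set) \<noteq> {0} \<and>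
     (\<forall>U W. subrep n scale \<rho> U \<and> subrep n scale \<rho> W \<and>
            U \<inter> W = {0} \<and> (\<forall>v. \<exists>u \<in> U. \<exists>w \<in> W. v = u + w)
        \<longrightarrow> U = {0} \<or> W = {0})"

definition calibrated ::
    "nat \<Rightarrow> (complex \<Rightarrow> 'v \<Rightarrow> 'v) \<Rightarrow> (free_alg set \<Rightarrow> 'v::ab_group_add \<Rightarrow> 'v) \<Rightarrow> bool" where
  "calibrated n scale \<rho> \<longleftrightarrow>
     (\<exists>B. \<not> module.dependent scale B \<and> module.span scale B = UNIV \<and>
          (\<forall>j \<in> {1..n}. \<forall>b \<in> B. \<exists>c. \<rho> (cls n (fy j)) b = scale c b))"

end

(* On a basis of common eigenvectors of the y_j with eigenvalues a, Theta acts by the product of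
   all 1 - (a_p - a_q)^2.  Theta is central on V: everything in the image of e_i has
   a_i - a_{i+1} = 1, and e_i kills a weight vector unless a_i - a_{i+1} = -1, so
   Theta e_i = e_i Theta = 0.  For s_i and a weight vector b with (a_i - a_{i+1})^2 = 1, also
   s_i b satisfies (y_i - y_{i+1})^2 s_i b = s_i b, so Theta kills both; otherwise e_i b = 0, and
   then s_i b is an eigenvector of y_i + y_{i+1} and y_i y_{i+1} with the eigenvalues of b, hence
   only involves the weight a and its swap, on which Theta takes the same value.
   So V is the direct sum of the subrepresentations ker Theta and im Theta, one of which is 0;
   ker Theta contains the nonzero image of some e_i. *)
theory Submission
  imports Defs "HOL-Combinatorics.Transposition"
begin

section \<open>Diagonalisable operators\<close>

lemma (in vector_space) linear_eq_on_basis: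
  assumes "Vector_Spaces.linear scale scale f" and "Vector_Spaces.linear scale scale g"
    and "span B = UNIV" and "\<And>b. b \<in> B \<Longrightarrow> f b = g b"
  shows "f v = g v"
proof -
  interpret vector_space_pair scale scale ..
  show ?thesis
    using linear_eq_on[OF assms(1,2), of v B] assms(3,4) by auto
qed

text \<open>Both sides are linear in \<open>v\<close>, so induction over the span reduces the claim
  to basis vectors. For \<open>b\<close> outside \<open>B\<close> both sides are 0, since
  \<open>representation B v b\<close> vanishes there.\<close>

lemma (in vector_space) representation_diagonal:
  assumes "independent B" and "span B = UNIV"
    and "Vector_Spaces.linear scale scale f"
    and diag: "\<And>b. b \<in> B \<Longrightarrow> f b = scale (c b) b"
  shows "representation B (f v) b = c b * representation B v b"
proof -
  interpret f: Vector_Spaces.linear scale scale f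
    by (rule assms(3))
  have "v \<in> span B"
    using assms(2) by simp
  then show ?thesis
  proof (induction rule: span_induct_alt)
    case base
    then show ?case by (simp add: f.zero representation_zero)
  next
    case (step k x y)
    have "representation B x b = (if b = x then 1 else 0)"
      using representation_basis[OF assms(1)] step.hyps by auto
    then show ?case
      using step assms(1,2)
      by (simp add: f.add f.scale diag representation_add representation_scale algebra_simps)
  qed
qed

text \<open>Comparing coordinates with \<open>scale k v\<close> suffices. Serves to read off the
  action of Theta on a vector from the weights that occur in it.\<close>

lemma (in vector_space) diagonal_eigenvector_scale:
  assumes "independent B" and "span B = UNIV"
    and "Vector_Spaces.linear scale scale f"
    and "\<And>b. b \<in> B \<Longrightarrow> f b = scale (c b) b"
    and supp: "\<And>b. b \<in> B \<Longrightarrow> representation B v b \<noteq> 0 \<Longrightarrow> c b = k"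
  shows "f v = scale k v"
proof -
  have "representation B (f v) b = representation B (scale k v) b" for b
  proof -
    have "representation B (f v) b = c b * representation B v b"
      using representation_diagonal[OF assms(1-4)] .
    also have "\<dots> = k * representation B v b"
      using supp[of b] representation_ne_zero[of B v b] by (cases "representation B v b = 0") auto
    finally show ?thesis
      using assms(1,2) by (simp add: representation_scale)
  qed
  then have "representation B (f v) = representation B (scale k v)" ..
  then show ?thesis
    using sum_nonzero_representation_eq[OF assms(1)] assms(2) by (metis UNIV_I)
qed

text \<open>The coordinate of \<open>f v\<close> at \<open>b\<close> is computed in two ways and the
  nonzero factor is cancelled. Converse to \<open>diagonal_eigenvector_scale\<close>: an eigenvector
  equation restricts the weights that can occur.\<close>

lemma (in vector_space) eigenvector_support:
  assumes "independent B" and "span B = UNIV"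
    and "Vector_Spaces.linear scale scale f"
    and "\<And>b. b \<in> B \<Longrightarrow> f b = scale (c b) b"
    and "f v = scale k v" and "representation B v b \<noteq> 0"
  shows "c b = k"
proof -
  have "c b * representation B v b = k * representation B v b"
    using representation_diagonal[OF assms(1-4), of v b] assms(1,2,5)
    by (auto simp: representation_scale)
  then show ?thesis
    using assms(6) by (metis mult_right_cancel)
qed

section \<open>Values of Theta on weights\<close>

text \<open>The eigenvalue of Theta on a vector of weight \<open>a\<close>. A product over a set of
  pairs, unlike one over a list, can be reindexed by a transposition.\<close>

definition weight_value :: "nat \<Rightarrow> (nat \<Rightarrow> complex) \<Rightarrow> complex" where
  "weight_value n a = (\<Prod>(p, q) \<in> {(p, q). 1 \<le> p \<and> p < q \<and> q \<le> n}. 1 - (a p - a q)\<^sup>2)"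

lemma finite_pairs: "finite {(p, q). 1 \<le> p \<and> p < q \<and> q \<le> (n::nat)}"
  by (rule finite_subset[of _ "{..n} \<times> {..n}"]) auto

lemma weight_value_list:
  "prod_list [1 - (a p - a q)\<^sup>2. p \<leftarrow> [1..<n+1], q \<leftarrow> [p+1..<n+1]] = weight_value n a"
proof -
  let ?f = "\<lambda>p q. 1 - (a p - a q)\<^sup>2"
  have concat: "prod_list (concat xss) = prod_list (map prod_list xss)" for xss :: "complex list list"
    by (induction xss) auto
  have "prod_list [?f p q. p \<leftarrow> [1..<n+1], q \<leftarrow> [p+1..<n+1]] =
      (\<Prod>p \<in> {1..<n+1}. \<Prod>q \<in> {p+1..<n+1}. ?f p q)"
    by (simp only: concat map_map o_def prod.distinct_set_conv_list[OF distinct_upt, symmetric] set_upt)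
  also have "\<dots> = (\<Prod>(p, q) \<in> (SIGMA p:{1..<n+1}. {p+1..<n+1}). ?f p q)"
    by (rule prod.Sigma) auto
  also have "(SIGMA p:{1..<n+1}. {p+1..<n+1}) = {(p, q). 1 \<le> p \<and> p < q \<and> q \<le> n}"
    by auto
  finally show ?thesis
    by (simp only: weight_value_def)
qed

text \<open>The factor at the pair (i, i+1) vanishes.\<close>

lemma weight_value_eq_0:
  assumes "i \<in> {1..n-1}" and "(a i - a (i+1))\<^sup>2 = 1"
  shows "weight_value n a = 0"
  unfolding weight_value_def
proof (rule prod_zero[OF finite_pairs], rule bexI)
  show "(case (i, i+1) of (p, q) \<Rightarrow> 1 - (a p - a q)\<^sup>2) = 0"
    using assms(2) by simp
  show "(i, i+1) \<in> {(p, q). 1 \<le> p \<and> p < q \<and> q \<le> n}"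
    using assms(1) by auto
qed

lemma weight_value_transpose:
  assumes "i \<in> {1..n-1}"
  shows "weight_value n (a \<circ> transpose i (i+1)) = weight_value n a"
proof -
  let ?t = "transpose i (i+1)"
  \<comment> \<open>Only the pair (i, i+1) has its order reversed by the transposition.\<close>
  let ?\<sigma> = "\<lambda>(p, q). if (p, q) = (i, i+1) then (p, q) else (?t p, ?t q)"
  let ?P = "{(p, q). 1 \<le> p \<and> p < q \<and> q \<le> n}"
  have inv: "?\<sigma> (?\<sigma> x) = x" if "x \<in> ?P" for x
    using that by (auto simp: transpose_eq_iff)
  have mem: "?\<sigma> x \<in> ?P" if "x \<in> ?P" for x
    using that assms by (auto simp: transpose_def split: if_splits)
  show ?thesis
    unfolding weight_value_def
  proof (rule prod.reindex_bij_witness[of _ ?\<sigma> ?\<sigma>])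
    fix x assume "x \<in> ?P"
    \<comment> \<open>At the fixed pair (i, i+1) the two factors differ only by a sign inside the
      square; at all other pairs they coincide.\<close>
    then show "(case ?\<sigma> x of (p, q) \<Rightarrow> 1 - (a p - a q)\<^sup>2) =
        (case x of (p, q) \<Rightarrow> 1 - ((a \<circ> ?t) p - (a \<circ> ?t) q)\<^sup>2)"
      by (cases x) (simp add: power2_commute[of "a i"])
  qed (fact inv mem)+
qed

lemma weight_value_cong:
  "(\<And>k. k \<in> {1..n} \<Longrightarrow> a k = a' k) \<Longrightarrow> weight_value n a = weight_value n a'"
  unfolding weight_value_def by (rule prod.cong) auto

text \<open>Sum and product determine the two entries at i and i+1 up to order, and
  \<open>weight_value\<close> is invariant under exchanging them.\<close>

lemma weight_value_swap:
  assumes "i \<in> {1..n-1}"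
    and "\<And>k. k \<in> {1..n} \<Longrightarrow> k \<noteq> i \<Longrightarrow> k \<noteq> i + 1 \<Longrightarrow> a' k = a k"
    and sum: "a' i + a' (i+1) = a i + a (i+1)"
    and prd: "a' i * a' (i+1) = a i * a (i+1)"
  shows "weight_value n a' = weight_value n a"
proof -
  \<comment> \<open>\<open>a' i\<close> is a root of the quadratic whose roots are
    \<open>a i\<close> and \<open>a (i+1)\<close>, because the coefficients agree.\<close>
  have "(a' i - a i) * (a' i - a (i+1)) = 0"
  proof -
    have "a' i * a' i - (a i + a (i+1)) * a' i + a i * a (i+1) = 0"
      unfolding sum[symmetric] prd[symmetric] by (simp add: algebra_simps)
    then show ?thesis
      by (simp add: algebra_simps)
  qed
  then consider "a' i = a i" "a' (i+1) = a (i+1)" | "a' i = a (i+1)" "a' (i+1) = a i"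
    using sum by force
  then show ?thesis
  proof cases
    case 1
    show ?thesis
      by (rule weight_value_cong) (use 1 assms(2) in metis)
  next
    case 2
    have "weight_value n a' = weight_value n (a \<circ> transpose i (i+1))"
      by (rule weight_value_cong) (use 2 assms(2) in \<open>auto simp: transpose_def\<close>)
    then show ?thesis
      using weight_value_transpose[OF assms(1)] by simp
  qed
qed

section \<open>Calibrated representations\<close>

text \<open>Expansion into words in the generators; it reduces the centrality of Theta to a check on
  generators and scalars.\<close>

lemma free_alg_fscalar_sum:
  "(p :: free_alg) = (\<Sum>w \<in> Poly_Mapping.keys p.
      fscalar (Poly_Mapping.lookup p w) * prod_list (map fgen (letters w)))"
proof -
  have word: "prod_list (map fgen gs) = Poly_Mapping.single (Word gs) 1" for gs
  proof (induction gs)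
    case Nil
    have "(1 :: free_alg) = Poly_Mapping.single (Word []) 1"
      by (metis single_one zero_word_def)
    then show ?case by simp
  next
    case (Cons g gs)
    then show ?case by (simp add: fgen_def mult_single plus_word_def)
  qed
  have "fscalar c * prod_list (map fgen (letters w)) = Poly_Mapping.single w c" for c w
    by (simp add: word fscalar_def mult_single)
  then have "?thesis \<longleftrightarrow> p = (\<Sum>w \<in> Poly_Mapping.keys p.
      Poly_Mapping.single w (Poly_Mapping.lookup p w))"
    by (simp only:)
  moreover have "p = (\<Sum>w \<in> Poly_Mapping.keys p.
      Poly_Mapping.single w (Poly_Mapping.lookup p w))"
    by (rule poly_mapping_eqI)
      (simp add: lookup_sum lookup_single when_def in_keys_iff)
  ultimately show ?thesis by blast
qed

text \<open>Fixing an eigenbasis \<open>B\<close> and the weights \<open>wt\<close> turns the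
  existential statements in \<open>calibrated\<close> into data shared by all lemmas below.\<close>

locale calibrated_rep = vector_space scale
  for scale :: "complex \<Rightarrow> 'v::ab_group_add \<Rightarrow> 'v" +
  fixes n :: nat and \<rho> :: "free_alg set \<Rightarrow> 'v \<Rightarrow> 'v" and B :: "'v set"
    and wt :: "'v \<Rightarrow> nat \<Rightarrow> complex"
  assumes hom: "\<rho> \<in> ring_hom (periplectic n) (End_ring scale)"
    and scalars: "\<rho> (cls n (fscalar c)) = scale c"
    and indep: "independent B" and spanning: "span B = UNIV"
    and weights: "j \<in> {1..n} \<Longrightarrow> b \<in> B \<Longrightarrow> \<rho> (cls n (fy j)) b = scale (wt b j) b"
begin

section \<open>The induced action of the free algebra\<close>

abbreviation A :: "free_alg set" where "A \<equiv> carrier (free_algebra n)"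

text \<open>Pulling the representation back to the free algebra replaces computations with cosets by
  computations with polynomials in the generators.\<close>

definition T :: "free_alg \<Rightarrow> 'v \<Rightarrow> 'v" where "T p = \<rho> (cls n p)"

lemma T_hom: "T \<in> ring_hom (free_algebra n) (End_ring scale)"
  using ring_hom_trans[OF cls_hom hom] by (simp add: T_def[abs_def] o_def)

lemma T_linear: "p \<in> A \<Longrightarrow> Vector_Spaces.linear scale scale (T p)"
  using ring_hom_closed[OF T_hom] by (simp add: End_ring_def)

lemma T_add: "p \<in> A \<Longrightarrow> q \<in> A \<Longrightarrow> T (p + q) v = T p v + T q v"
  using ring_hom_add[OF T_hom, of p q] by (simp add: End_ring_def free_algebra_def)

lemma T_mult: "p \<in> A \<Longrightarrow> q \<in> A \<Longrightarrow> T (p * q) v = T p (T q v)"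
  using ring_hom_mult[OF T_hom, of p q] by (simp add: End_ring_def free_algebra_def)

lemma T_one: "T 1 v = v"
  using ring_hom_one[OF T_hom] by (simp add: End_ring_def free_algebra_def)

lemma T_zero: "T 0 v = 0"
  using T_add[of 0 0 v] by (simp add: free_algebra_def)

lemma T_diff: "p \<in> A \<Longrightarrow> q \<in> A \<Longrightarrow> T (p - q) v = T p v - T q v"
  using T_add[of "p - q" q v] by (simp add: free_algebra_minus_in)

lemma T_minus: "p \<in> A \<Longrightarrow> T (- p) v = - T p v"
  using T_diff[of 0 p v] by (simp add: T_zero free_algebra_def)

lemmas in_A = free_algebra_minus_in free_algebra_add_in free_algebra_mult_in free_algebra_neg_in
  free_algebra_one_in fgen_in gens_in fscalar_in

lemma T_apply_add: "p \<in> A \<Longrightarrow> T p (u + v) = T p u + T p v"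
  and T_apply_scale: "p \<in> A \<Longrightarrow> T p (scale c v) = scale c (T p v)"
  by (auto intro: module_hom.add module_hom.scale
      dest!: T_linear Vector_Spaces.linear.axioms(3))

lemma T_apply_zero: "p \<in> A \<Longrightarrow> T p 0 = 0"
  using T_apply_scale[of p 0 0] by simp

lemma T_apply_diff: "p \<in> A \<Longrightarrow> T p (u - v) = T p u - T p v"
  using T_apply_add[of p "u - v" v] by simp

lemma T_apply_minus: "p \<in> A \<Longrightarrow> T p (- v) = - T p v"
  using T_apply_diff[of p 0 v] by (simp add: T_apply_zero)

lemmas T_simps = T_diff T_add T_mult T_one T_minus
  T_apply_add T_apply_diff T_apply_zero T_apply_minus T_apply_scale

lemma T_relator:
  assumes "r \<in> relators n"
  shows "T r v = 0"
proof -
  have "\<zero>\<^bsub>periplectic n\<^esub> = cls n 0"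
    using ring_hom_zero[OF cls_hom ring_free_algebra ring_periplectic]
    by (simp add: free_algebra_def)
  then show ?thesis
    using cls_rel[OF assms] T_zero by (simp add: T_def)
qed

lemma T_power2: "p \<in> A \<Longrightarrow> T (p\<^sup>2) v = T p (T p v)"
  by (simp add: power2_eq_square T_mult)

lemma prod_list_in_A: "set ps \<subseteq> A \<Longrightarrow> prod_list ps \<in> A"
  by (induction ps) (auto intro: in_A)

lemma T_prod_list_eigenvector:
  assumes "\<And>x. x \<in> set xs \<Longrightarrow> f x \<in> A"
    and "\<And>x. x \<in> set xs \<Longrightarrow> T (f x) v = scale (c x) v"
  shows "T (prod_list (map f xs)) v = scale (prod_list (map c xs)) v"
  using assms
proof (induction xs)
  case (Cons x xs)
  moreover have "prod_list (map f xs) \<in> A"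
    using Cons.prems(1) by (intro prod_list_in_A) auto
  ultimately show ?case
    by (simp add: T_mult T_apply_scale mult.commute)
qed (simp add: T_one)

section \<open>The action of Theta on weight vectors\<close>

definition th :: free_alg where
  "th = prod_list [1 - (fy p - fy q)\<^sup>2. p \<leftarrow> [1..<n+1], q \<leftarrow> [p+1..<n+1]]"

lemma Theta_eq: "\<rho> (Theta n) = T th"
  by (simp add: T_def th_def Theta_def)

lemma th_in_A: "th \<in> A"
  unfolding th_def by (rule prod_list_in_A) (auto simp: power2_eq_square intro!: in_A)

lemma fy_in_A: "j \<in> {1..n} \<Longrightarrow> fy j \<in> A"
  by (intro in_A)

lemma T_fy: "j \<in> {1..n} \<Longrightarrow> b \<in> B \<Longrightarrow> T (fy j) b = scale (wt b j) b"
  by (simp add: T_def weights)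

lemma T_th:
  assumes "b \<in> B"
  shows "T th b = scale (weight_value n (wt b)) b"
proof -
  \<comment> \<open>Flattening the nested comprehension to one list of pairs makes
    \<open>T_prod_list_eigenvector\<close> applicable.\<close>
  let ?L = "[(p, q). p \<leftarrow> [1..<n+1], q \<leftarrow> [p+1..<n+1]]"
  have factor: "T (1 - (fy p - fy q)\<^sup>2) b = scale (1 - (wt b p - wt b q)\<^sup>2) b"
    if "p \<in> {1..n}" "q \<in> {1..n}" for p q
  proof -
    have "T (fy p - fy q) b = scale (wt b p - wt b q) b"
      using that assms by (simp add: T_diff fy_in_A T_fy scale_left_diff_distrib)
    then show ?thesis
      using that
      by (simp add: T_diff T_one T_mult T_apply_scale power2_eq_square free_algebra_one_in
          free_algebra_minus_in free_algebra_mult_in fy_in_A scale_left_diff_distrib[of 1])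
  qed
  have "T (prod_list (map (\<lambda>(p, q). 1 - (fy p - fy q)\<^sup>2) ?L)) b =
      scale (prod_list (map (\<lambda>(p, q). 1 - (wt b p - wt b q)\<^sup>2) ?L)) b"
  proof (rule T_prod_list_eigenvector)
    fix x assume "x \<in> set ?L"
    moreover have "set ?L \<subseteq> {1..n} \<times> {1..n}"
      by auto
    ultimately obtain p q where "x = (p, q)" "p \<in> {1..n}" "q \<in> {1..n}"
      by blast
    then show "(case x of (p, q) \<Rightarrow> 1 - (fy p - fy q)\<^sup>2) \<in> A"
      and "T (case x of (p, q) \<Rightarrow> 1 - (fy p - fy q)\<^sup>2) b =
        scale (case x of (p, q) \<Rightarrow> 1 - (wt b p - wt b q)\<^sup>2) b"
      using factor[of p q]
      by (simp_all add: power2_eq_square free_algebra_minus_in free_algebra_mult_in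
          free_algebra_one_in fy_in_A)
  qed
  then show ?thesis
    unfolding th_def weight_value_list[symmetric] by (simp add: map_concat o_def)
qed

lemma th_scaleI:
  assumes "\<And>b. b \<in> B \<Longrightarrow> representation B v b \<noteq> 0 \<Longrightarrow> weight_value n (wt b) = k"
  shows "T th v = scale k v"
  by (rule diagonal_eigenvector_scale[OF indep spanning T_linear[OF th_in_A] T_th assms])

text \<open>Every weight occurring in \<open>v\<close> has difference 1 or -1 at i, i+1, so Theta
  vanishes on each of them. The square treats both signs at once.\<close>

lemma th_zeroI:
  assumes i: "i \<in> {1..n-1}"
    and sq: "T ((fy i - fy (i+1))\<^sup>2) v = v"
  shows "T th v = 0"
proof -
  let ?d = "fy i - fy (i+1)"
  have d: "?d \<in> A" "?d\<^sup>2 \<in> A"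
    using i by (auto simp: power2_eq_square intro!: in_A)
  have dw: "T ?d b = scale (wt b i - wt b (i+1)) b" if "b \<in> B" for b
    using i that T_fy[of i b] T_fy[of "i+1" b]
    by (auto simp: T_diff fy_in_A scale_left_diff_distrib)
  have "T (?d\<^sup>2) b = scale ((wt b i - wt b (i+1))\<^sup>2) b" if "b \<in> B" for b
    using T_power2[OF d(1), of b] dw[OF that] T_apply_scale[OF d(1)]
    by (simp add: power2_eq_square[of "_ - _ :: complex"])
  then have "(wt b i - wt b (i+1))\<^sup>2 = 1" if "representation B v b \<noteq> 0" for b
    using eigenvector_support[OF indep spanning T_linear[OF d(2)] _ _ that,
        of "\<lambda>b. (wt b i - wt b (i+1))\<^sup>2" 1] sq
    by simp
  then show ?thesis
    using th_scaleI[of v 0] weight_value_eq_0[OF i] by simp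
qed

section \<open>Commutation of Theta with e_i and s_i\<close>

context
  fixes i assumes i: "i \<in> {1..n-1}"
begin

lemma gens_in_A: "fs i \<in> A" "fe i \<in> A" "fy i \<in> A" "fy (i+1) \<in> A" "fy (Suc i) \<in> A"
  using i by (auto intro!: in_A)

lemma sy: "T (fs i) (T (fy i) v) = T (fy (i+1)) (T (fs i) v) - T (fe i) v - v"
  using T_relator[OF relators.sy[OF i], of v] by (simp add: T_simps in_A gens_in_A algebra_simps)

lemma sy': "T (fs i) (T (fy (i+1)) v) = T (fy i) (T (fs i) v) - T (fe i) v + v"
  using T_relator[OF relators.ys[OF i], of v] by (simp add: T_simps in_A gens_in_A algebra_simps)

lemma ey: "T (fe i) (T (fy i) v) - T (fe i) (T (fy (i+1)) v) = - T (fe i) v"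
  using T_relator[OF relators.ey[OF i], of v]
  by (simp add: T_simps in_A gens_in_A algebra_simps eq_neg_iff_add_eq_0)

lemma ye: "T (fy i) (T (fe i) v) - T (fy (i+1)) (T (fe i) v) = T (fe i) v"
  using T_relator[OF relators.ye[OF i], of v]
  by (simp add: T_simps in_A gens_in_A algebra_simps)

lemma s_yk:
  "k \<in> {1..n} \<Longrightarrow> k \<noteq> i \<Longrightarrow> k \<noteq> i + 1 \<Longrightarrow> T (fs i) (T (fy k) v) = T (fy k) (T (fs i) v)"
  using T_relator[OF relators.s_y[OF i], of k v] by (simp add: T_simps in_A gens_in_A fy_in_A)

lemma th_e: "T th (T (fe i) v) = 0"
  by (rule th_zeroI[OF i]) (use ye[of v] in \<open>simp add: T_power2 T_simps in_A gens_in_A\<close>)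

text \<open>Evaluating e_i (y_i - y_{i+1}) = -e_i at \<open>b\<close> shows that
  \<open>wt b i - wt b (i+1) + 1\<close> annihilates e_i b.\<close>

lemma e_eq_0:
  assumes "b \<in> B" and "wt b i - wt b (i+1) \<noteq> - 1"
  shows "T (fe i) b = 0"
proof -
  have "scale (wt b i - wt b (i+1) + 1) (T (fe i) b) = 0"
    using ey[of b] assms(1) i T_fy[of i b] T_fy[of "i+1" b]
    by (auto simp: T_apply_scale gens_in_A scale_left_diff_distrib scale_left_distrib)
  moreover have "wt b i - wt b (i+1) + 1 \<noteq> 0"
    using assms(2) by (simp add: eq_neg_iff_add_eq_0)
  ultimately show ?thesis by (simp only: scale_eq_0_iff) simp
qed

lemma e_th:
  assumes "b \<in> B"
  shows "T (fe i) (T th b) = 0"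
proof (cases "wt b i - wt b (i+1) = - 1")
  case True
  then show ?thesis
    using weight_value_eq_0[OF i, of "wt b"] assms by (simp add: T_th T_simps gens_in_A)
next
  case False
  then show ?thesis
    using e_eq_0[OF assms] assms by (simp add: T_th T_simps gens_in_A)
qed

lemma th_s:
  assumes b: "b \<in> B"
  shows "T th (T (fs i) b) = scale (weight_value n (wt b)) (T (fs i) b)"
proof (cases "(wt b i - wt b (i+1))\<^sup>2 = 1")
  case True
  let ?d = "fy i - fy (i+1)" and ?c = "wt b i - wt b (i+1)" and ?u = "T (fs i) b"
  have d: "?d \<in> A"
    by (intro in_A gens_in_A)
  have db: "T ?d b = scale ?c b"
    using i b T_fy[of i b] T_fy[of "i+1" b]
    by (auto simp: T_diff fy_in_A scale_left_diff_distrib)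
  \<comment> \<open>Subtracting \<open>sy'\<close> from \<open>sy\<close> cancels the e_i terms and
    leaves s_i d = -d s_i - 2 for d = y_i - y_{i+1}.\<close>
  have "T (fs i) (T ?d b) = - T ?d ?u - b - b"
    unfolding T_diff[OF gens_in_A(3,4)] T_apply_diff[OF gens_in_A(1)] sy sy'
    by (simp add: algebra_simps)
  moreover have "y = - x - b - b" if "x = - y - b - b" for x y :: 'v
    unfolding that by simp
  ultimately have du: "T ?d ?u = - scale ?c ?u - b - b"
    unfolding db T_apply_scale[OF gens_in_A(1)] by blast
  \<comment> \<open>Applying d to -c u - 2 b gives c^2 u + 2 c b - 2 c b, so the terms in b cancel;
    here c^2 = 1.\<close>
  have "T ?d (T ?d ?u) = scale (?c\<^sup>2) ?u"
    unfolding du T_apply_diff[OF d] T_apply_minus[OF d] T_apply_scale[OF d] db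
    by (simp add: scale_right_diff_distrib power2_eq_square)
  then have "T th ?u = 0"
    using True d by (intro th_zeroI[OF i]) (simp add: T_power2)
  then show ?thesis
    using weight_value_eq_0[OF i True] by simp
next
  case False
  let ?u = "T (fs i) b" and ?x = "wt b i" and ?y = "wt b (i+1)"
  have e0: "T (fe i) b = 0"
    using False by (intro e_eq_0[OF b]) auto
  have yb: "T (fy i) b = scale ?x b" "T (fy (i+1)) b = scale ?y b"
    using i b by (auto simp: T_fy)
  have s1: "T (fy (i+1)) ?u = scale ?x ?u + b"
    using sy[of b] unfolding e0 yb by (simp add: T_apply_scale gens_in_A)
  have s2: "T (fy i) ?u = scale ?y ?u - b"
    using sy'[of b] unfolding e0 yb by (simp add: T_apply_scale gens_in_A)
  \<comment> \<open>The extra terms b and -b in \<open>s1\<close> and \<open>s2\<close> cancel in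
    the symmetric functions of y_i and y_{i+1}, which makes u an eigenvector of these.\<close>
  have sum: "T (fy i + fy (i+1)) ?u = scale (?x + ?y) ?u"
    using s1 s2 by (simp add: T_add gens_in_A scale_left_distrib)
  have prd: "T (fy i * fy (i+1)) ?u = scale (?x * ?y) ?u"
    using s1 s2 yb by (simp add: T_mult gens_in_A T_apply_add T_apply_scale scale_right_diff_distrib)
  have wts: "\<And>b'. b' \<in> B \<Longrightarrow> T (fy i + fy (i+1)) b' = scale (wt b' i + wt b' (i+1)) b'"
      "\<And>b'. b' \<in> B \<Longrightarrow> T (fy i * fy (i+1)) b' = scale (wt b' i * wt b' (i+1)) b'"
    using i T_fy[of i] T_fy[of "i+1"] by (auto simp: T_add T_mult gens_in_A T_apply_scale scale_left_distrib mult.commute)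
  show ?thesis
  proof (rule th_scaleI)
    \<comment> \<open>A weight occurring in u has the sum and product of \<open>wt b\<close> at i,
      i+1. Its other entries agree with \<open>wt b\<close> because s_i commutes with the remaining
      y_k.\<close>
    fix b' assume b': "b' \<in> B" and nz: "representation B ?u b' \<noteq> 0"
    show "weight_value n (wt b') = weight_value n (wt b)"
    proof (rule weight_value_swap[OF i])
      show "wt b' i + wt b' (i+1) = wt b i + wt b (i+1)"
        by (rule eigenvector_support[OF indep spanning T_linear wts(1) sum nz])
          (intro in_A gens_in_A)
      show "wt b' i * wt b' (i+1) = wt b i * wt b (i+1)"
        by (rule eigenvector_support[OF indep spanning T_linear wts(2) prd nz])
          (intro in_A gens_in_A)
      fix k assume k: "k \<in> {1..n}" "k \<noteq> i" "k \<noteq> i + 1"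
      have ev: "T (fy k) ?u = scale (wt b k) ?u"
        using s_yk[OF k, of b] b k(1) by (simp add: T_fy T_apply_scale gens_in_A)
      show "wt b' k = wt b k"
        by (rule eigenvector_support[OF indep spanning T_linear[OF fy_in_A[OF k(1)]]
            T_fy[OF k(1)] ev nz])
    qed
  qed
qed

end

section \<open>Centrality of Theta on the representation\<close>

lemma th_commute_gen:
  assumes "g \<in> gens n"
  shows "T th (T (fgen g) v) = T (fgen g) (T th v)"
proof -
  have g: "fgen g \<in> A"
    by (rule fgen_in[OF assms])
  have "T th (T (fgen g) b) = T (fgen g) (T th b)" if "b \<in> B" for b
    using assms unfolding gens_def
  proof (elim UnE imageE)
    fix i assume "g = Gen_s i" "i \<in> {1..n-1}"
    then show ?thesis
      using that g by (simp add: th_s T_th T_apply_scale)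
  next
    fix i assume "g = Gen_e i" "i \<in> {1..n-1}"
    then show ?thesis
      using that by (simp add: th_e e_th)
  next
    fix i assume "g = Gen_y i" "i \<in> {1..n}"
    then show ?thesis
      using that g by (simp add: T_fy T_th T_apply_scale th_in_A mult.commute)
  qed
  then show ?thesis
    \<comment> \<open>Both compositions are actions of elements of the free algebra, hence linear,
      so agreement on \<open>B\<close> is enough.\<close>
    using linear_eq_on_basis[OF T_linear T_linear spanning, of "th * fgen g" "fgen g * th" v]
      g th_in_A by (simp add: T_mult free_algebra_mult_in)
qed

lemma th_commute:
  assumes "p \<in> A"
  shows "T th (T p v) = T p (T th v)"
proof -
  let ?m = "\<lambda>w. fscalar (Poly_Mapping.lookup p w) * prod_list (map fgen (letters w))"
  \<comment> \<open>The commutant of Theta. Membership in \<open>A\<close> is carried along because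
    \<open>T_mult\<close> and \<open>T_add\<close> require it.\<close>
  let ?C = "{q \<in> A. \<forall>v. T th (T q v) = T q (T th v)}"
  have word: "prod_list (map fgen gs) \<in> ?C" if "set gs \<subseteq> gens n" for gs
    using that
    by (induction gs) (auto simp: T_mult T_one in_A th_commute_gen)
  have monom: "?m w \<in> ?C" if "w \<in> Poly_Mapping.keys p" for w
  proof -
    have "set (letters w) \<subseteq> gens n"
      using assms that by (auto simp: free_algebra_def)
    then show ?thesis
      using word[of "letters w"]
      by (simp add: T_mult in_A T_def[of "fscalar _"] scalars T_apply_scale th_in_A)
  qed
  \<comment> \<open>The induction runs over subsets of the support, so that the coefficients, taken
    from \<open>p\<close>, stay fixed.\<close>
  have "(\<Sum>w \<in> K. ?m w) \<in> ?C" if "finite K" "K \<subseteq> Poly_Mapping.keys p" for K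
    using that(1,2)
  proof (induction K rule: finite_induct)
    case empty
    then show ?case by (simp add: T_zero T_apply_zero th_in_A) (simp add: free_algebra_def)
  next
    case (insert w K)
    then have "?m w \<in> ?C" "(\<Sum>w \<in> K. ?m w) \<in> ?C"
      using monom by auto
    with insert.hyps show ?case by (simp add: T_add T_apply_add th_in_A free_algebra_add_in)
  qed
  then have "p \<in> ?C"
    by (subst free_alg_fscalar_sum[of p]) simp
  then show ?thesis by blast
qed

section \<open>Splitting into kernel and image of Theta\<close>

lemma carrier_periplectic: "a \<in> carrier (periplectic n) \<Longrightarrow> \<exists>p \<in> A. a = cls n p"
  by (auto simp: periplectic_def FactRing_def A_RCOSETS_def' cls_def)

lemma subrep_kernel: "subrep n scale \<rho> {v. T th v = 0}"
proof -
  have "subspace {v. T th v = 0}"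
    by (auto simp: subspace_def T_apply_zero T_apply_add T_apply_scale th_in_A)
  moreover have "T th (\<rho> a u) = 0"
    if a: "a \<in> carrier (periplectic n)" and u: "T th u = 0" for a u
  proof -
    obtain p where "p \<in> A" "a = cls n p"
      using carrier_periplectic[OF a] by blast
    then show ?thesis
      using th_commute[of p u] u by (simp add: T_apply_zero flip: T_def)
  qed
  ultimately show ?thesis
    by (simp add: subrep_def)
qed

lemma subrep_range: "subrep n scale \<rho> (range (T th))"
proof -
  have "subspace (range (T th))"
    unfolding subspace_def
  proof (intro conjI ballI allI)
    show "0 \<in> range (T th)"
      using T_apply_zero[OF th_in_A] by (metis rangeI)
  qed (auto simp flip: T_apply_add[OF th_in_A] T_apply_scale[OF th_in_A])
  moreover have "\<rho> a (T th u) \<in> range (T th)"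
    if a: "a \<in> carrier (periplectic n)" for a u
  proof -
    obtain p where "p \<in> A" "a = cls n p"
      using carrier_periplectic[OF a] by blast
    then show ?thesis
      using th_commute[of p u] by (metis T_def rangeI)
  qed
  ultimately show ?thesis
    by (auto simp: subrep_def)
qed

text \<open>Theta is diagonal, so its square has the same kernel: the square of a complex number is
  0 only if the number is 0.\<close>

lemma kernel_Int_range: "{v. T th v = 0} \<inter> range (T th) = {0}"
proof -
  have "T th v = 0" if "T th (T th v) = 0" for v
  proof -
    have rep: "representation B (T th u) b = weight_value n (wt b) * representation B u b" for u b
      by (rule representation_diagonal[OF indep spanning T_linear[OF th_in_A] T_th])
    have "weight_value n (wt b) * (weight_value n (wt b) * representation B v b) = 0" for b
      using that rep[of "T th v" b] rep[of v b] by (simp add: representation_zero)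
    then have "weight_value n (wt b) = 0" if "representation B v b \<noteq> 0" for b
      using that by (metis mult_eq_0_iff)
    then show ?thesis
      using th_scaleI[of v 0] by simp
  qed
  then show ?thesis
    using T_apply_zero[OF th_in_A] by (auto intro: rev_image_eqI)
qed

text \<open>Each basis vector lies in the kernel or in the image, according to whether its
  eigenvalue under Theta is 0.\<close>

lemma kernel_plus_range: "\<exists>u \<in> {v. T th v = 0}. \<exists>w \<in> range (T th). v = u + w"
proof -
  have "v \<in> span B"
    using spanning by simp
  then show ?thesis
  proof (induction rule: span_induct_alt)
    case base
    then show ?case
      using T_apply_zero[OF th_in_A] by (intro bexI[of _ 0]) (auto intro: rev_image_eqI)
  next
    case (step c b v)
    then obtain u w where uw: "T th u = 0" "v = u + T th w"
      by blast
    show ?case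
    proof (cases "weight_value n (wt b) = 0")
      case True
      then have "T th (scale c b + u) = 0"
        using uw(1) step.hyps by (simp add: T_apply_add T_apply_scale th_in_A T_th)
      then show ?thesis
        using uw(2) by (intro bexI[of _ "scale c b + u"] bexI[of _ "T th w"]) (auto simp: add.assoc)
    next
      case False
      \<comment> \<open>Dividing by the nonzero eigenvalue yields a preimage of the new
        summand.\<close>
      then have "T th (scale (c / weight_value n (wt b)) b + w) = scale c b + T th w"
        using step.hyps by (simp add: T_apply_add T_apply_scale th_in_A T_th)
      then have "scale c b + v = u + T th (scale (c / weight_value n (wt b)) b + w)"
        using uw(2) by (simp add: algebra_simps)
      then show ?thesis
        using uw(1) by blast
    qed
  qed
qed

lemma indecomposable_cases:
  assumes "indecomposable n scale \<rho>"
  shows "{v. T th v = 0} = {0} \<or> range (T th) = {0}"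
  using assms subrep_kernel subrep_range kernel_Int_range kernel_plus_range
  unfolding indecomposable_def by blast

end

theorem theorem24:
  fixes n :: nat
    and scale :: "complex \<Rightarrow> 'v::ab_group_add \<Rightarrow> 'v"
    and \<rho> :: "free_alg set \<Rightarrow> 'v \<Rightarrow> 'v"
  assumes "n \<ge> 2"
    and "fin_dim_rep n scale \<rho>"
    and "indecomposable n scale \<rho>"
    and "calibrated n scale \<rho>"
    and "\<exists>i \<in> {1..n-1}. \<rho> (cls n (fe i)) \<noteq> (\<lambda>v. 0)"
  shows "\<rho> (Theta n) = (\<lambda>v. 0)"
proof -
  obtain B where B: "\<not> module.dependent scale B" "module.span scale B = UNIV"
      "\<forall>j \<in> {1..n}. \<forall>b \<in> B. \<exists>c. \<rho> (cls n (fy j)) b = scale c b"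
    using assms(4) unfolding calibrated_def by blast
  \<comment> \<open>The choice is a genuine eigenvalue for \<open>b\<close> in \<open>B\<close> and
    j in \<open>{1..n}\<close>; elsewhere it is arbitrary.\<close>
  define wt where "wt b j = (SOME c. \<rho> (cls n (fy j)) b = scale c b)" for b j
  have wt: "\<rho> (cls n (fy j)) b = scale (wt b j) b" if "j \<in> {1..n}" "b \<in> B" for j b
    unfolding wt_def by (rule someI_ex) (use B(3) that in blast)
  obtain B0 where "finite_dimensional_vector_space scale B0"
    using assms(2) unfolding fin_dim_rep_def by blast
  then have "vector_space scale"
    by (simp add: finite_dimensional_vector_space_def)
  then interpret calibrated_rep scale n \<rho> B wt
    using B wt assms(2)
    by (auto simp: calibrated_rep_def calibrated_rep_axioms_def fin_dim_rep_def)
  obtain i v where i: "i \<in> {1..n-1}" and v: "T (fe i) v \<noteq> 0"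
    using assms(5) by (auto simp: T_def fun_eq_iff)
  \<comment> \<open>The nonzero vector e_i v lies in the kernel by \<open>th_e\<close>, so
    indecomposability forces the image to be 0.\<close>
  have "{v. T th v = 0} \<noteq> {0}"
    using th_e[OF i, of v] v by blast
  then have "range (T th) = {0}"
    using indecomposable_cases[OF assms(3)] by blast
  then show ?thesis
    unfolding Theta_eq by (auto simp: fun_eq_iff)
qed

end
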